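(* Let $(X,\omega)$ be a holomorphic symplectic manifold with holomorphic symplectic 2-form $\omega\in\Omega^{2,0}(X)$, and let $\pi\in\Gamma(\wedge^2T^{1,0}X)$ be the corresponding holomorphic Poisson bivector field. Write $\omega=\omega_R+i\omega_I$ with $\omega_R,\omega_I$ real 2-forms, and $\pi=\pi_R+i\pi_I$ with $\pi_R,\pi_I$ real bivector fields. Then the Poisson bivector fields corresponding to the (real) symplectic forms $\omega_R$ and $\omega_I$ are $4\pi_R$ and $-4\pi_I$, respectively.
   Context: A holomorphic symplectic form is a closed holomorphic $(2,0)$-form that is nondegenerate on $T^{1,0}X$; its real and imaginary parts are then real symplectic forms. The Poisson bivector field $P$ corresponding to a symplectic form $\sigma$ is determined by $P^\sharp=(\sigma^\flat)^{-1}$, where $\sigma^\flat(V)=\sigma(V,\cdot)$ and $\langle\beta,P^\sharp\alpha\rangle=P(\alpha,\beta)$; in the holomorphic case $\omega^\flat:T^{1,0}X\to(T^{1,0}X)^*$ is used. (For instance $dz\wedge dz'$ corresponds to $-\frac{\partial}{\partial z}\wedge\frac{\partial}{\partial z'}$; the same convention is used in the real and holomorphic cases.) *)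

theory Defs
  imports "HOL-Analysis.Analysis" "HOL-Library.Function_Algebras"
begin

instantiation "fun" :: (type, real_vector) real_vector
begin

definition scaleR_fun :: "real \<Rightarrow> ('a \<Rightarrow> 'b) \<Rightarrow> 'a \<Rightarrow> 'b"
  where "scaleR_fun r f = (\<lambda>x. r *\<^sub>R f x)"

instance
  by standard (simp_all add: scaleR_fun_def fun_eq_iff scaleR_add_right scaleR_add_left)

end


section \<open>Smooth and holomorphic functions on open sets\<close>

primrec Ck_on :: "nat \<Rightarrow> ('e::real_normed_vector \<Rightarrow> 'f::real_normed_vector) \<Rightarrow> 'e set \<Rightarrow> bool"
  where
    "Ck_on 0 f S \<longleftrightarrow> continuous_on S f"
  | "Ck_on (Suc k) f S \<longleftrightarrow> (\<forall>x\<in>S. f differentiable (at x)) \<and>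
       (\<forall>v. Ck_on k (\<lambda>x. frechet_derivative f (at x) v) S)"

definition smooth_on :: "('e::real_normed_vector \<Rightarrow> 'f::real_normed_vector) \<Rightarrow> 'e set \<Rightarrow> bool"
  where "smooth_on f S \<longleftrightarrow> (\<forall>k. Ck_on k f S)"

text \<open>
  Holomorphic functions of several variables: smooth functions satisfying the Cauchy--Riemann
  equations, i.e. whose real derivative is complex linear.
\<close>

definition holomorphic_fun_on :: "(complex ^ 'n::finite \<Rightarrow> complex) \<Rightarrow> (complex ^ 'n) set \<Rightarrow> bool"
  where "holomorphic_fun_on f S \<longleftrightarrow> smooth_on f S \<and>
    (\<forall>x\<in>S. \<forall>a v. frechet_derivative f (at x) (a *s v) = a * frechet_derivative f (at x) v)"


section \<open>Linear algebra on subspaces\<close>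

text \<open>
  The parameters \<open>s\<close> and \<open>t\<close> are the scalar multiplications of source and target.
  Elements of a dual space are functions on the whole type; they are normalised to vanish outside
  the subspace, so that equality of functions is equality of functionals.
\<close>

definition linear_wrt ::
    "('k \<Rightarrow> 'v \<Rightarrow> 'v) \<Rightarrow> ('k \<Rightarrow> 'w \<Rightarrow> 'w) \<Rightarrow> 'v::plus set \<Rightarrow> ('v \<Rightarrow> 'w::plus) \<Rightarrow> bool"
  where "linear_wrt s t V f \<longleftrightarrow>
    (\<forall>u\<in>V. \<forall>v\<in>V. f (u + v) = f u + f v) \<and> (\<forall>a. \<forall>v\<in>V. f (s a v) = t a (f v))"

definition alternating_wrt ::
    "('k \<Rightarrow> 'v \<Rightarrow> 'v) \<Rightarrow> ('k \<Rightarrow> 'w \<Rightarrow> 'w) \<Rightarrow> 'v::plus set \<Rightarrow> ('v \<Rightarrow> 'v \<Rightarrow> 'w::{plus,zero}) \<Rightarrow> bool"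
  where "alternating_wrt s t V B \<longleftrightarrow>
    (\<forall>u\<in>V. linear_wrt s t V (B u)) \<and> (\<forall>v\<in>V. linear_wrt s t V (\<lambda>u. B u v)) \<and>
    (\<forall>u\<in>V. B u u = 0)"

definition nondegenerate_on :: "'v::zero set \<Rightarrow> ('v \<Rightarrow> 'v \<Rightarrow> 'k::zero) \<Rightarrow> bool"
  where "nondegenerate_on V B \<longleftrightarrow> (\<forall>u\<in>V. (\<forall>v\<in>V. B u v = 0) \<longrightarrow> u = 0)"

definition restrict0 :: "'v set \<Rightarrow> ('v \<Rightarrow> 'k::zero) \<Rightarrow> 'v \<Rightarrow> 'k"
  where "restrict0 V f = (\<lambda>v. if v \<in> V then f v else 0)"

definition dual_on :: "('k \<Rightarrow> 'v \<Rightarrow> 'v) \<Rightarrow> 'v::plus set \<Rightarrow> ('v \<Rightarrow> 'k::{plus,times,zero}) set"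
  where "dual_on s V = {\<alpha>. linear_wrt s (*) V \<alpha> \<and> (\<forall>v. v \<notin> V \<longrightarrow> \<alpha> v = 0)}"

definition flat :: "'v set \<Rightarrow> ('v \<Rightarrow> 'v \<Rightarrow> 'k::zero) \<Rightarrow> 'v \<Rightarrow> ('v \<Rightarrow> 'k)"
  where "flat V B u = restrict0 V (B u)"

text \<open>
  Bivectors on a finite-dimensional space \<open>V\<close> are alternating bilinear forms on the dual \<open>V'\<close> of
  \<open>V\<close>; a decomposable bivector \<open>u \<and> v\<close> is \<open>(\<alpha>, \<beta>) \<mapsto> \<alpha>(u) \<beta>(v) - \<alpha>(v) \<beta>(u)\<close>.
\<close>

definition sharp :: "'v set \<Rightarrow> ('v \<Rightarrow> 'k) set \<Rightarrow> (('v \<Rightarrow> 'k) \<Rightarrow> ('v \<Rightarrow> 'k) \<Rightarrow> 'k) \<Rightarrow> ('v \<Rightarrow> 'k) \<Rightarrow> 'v"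
  where "sharp V V' P \<alpha> = (THE v. v \<in> V \<and> (\<forall>\<beta>\<in>V'. \<beta> v = P \<alpha> \<beta>))"

definition sharp_inverse_flat ::
    "'v set \<Rightarrow> ('v \<Rightarrow> 'k::zero) set \<Rightarrow> ('v \<Rightarrow> 'v \<Rightarrow> 'k) \<Rightarrow> (('v \<Rightarrow> 'k) \<Rightarrow> ('v \<Rightarrow> 'k) \<Rightarrow> 'k) \<Rightarrow> bool"
  where "sharp_inverse_flat V V' B P \<longleftrightarrow> bij_betw (flat V B) V V' \<and>
    (\<forall>\<alpha>\<in>V'. sharp V V' P \<alpha> = inv_into V (flat V B) \<alpha>)"

text \<open>
  The complexification of a real vector space \<open>V\<close> is \<open>V \<times> V\<close>, where \<open>(u, v)\<close> stands for
  \<open>u + \<i> v\<close>. Below are its scalar multiplication and the complex (bi)linear extensions of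
  complex-valued functionals and bilinear forms on \<open>V\<close>.
\<close>

definition cscale :: "complex \<Rightarrow> 'v \<times> 'v \<Rightarrow> 'v \<times> 'v::real_vector"
  where "cscale a w =
    (Re a *\<^sub>R fst w - Im a *\<^sub>R snd w, Re a *\<^sub>R snd w + Im a *\<^sub>R fst w)"

definition cext :: "('v \<Rightarrow> complex) \<Rightarrow> 'v \<times> 'v \<Rightarrow> complex"
  where "cext \<alpha> w = \<alpha> (fst w) + \<i> * \<alpha> (snd w)"

definition cext2 :: "('v \<Rightarrow> 'v \<Rightarrow> complex) \<Rightarrow> 'v \<times> 'v \<Rightarrow> 'v \<times> 'v \<Rightarrow> complex"
  where "cext2 B w z = B (fst w) (fst z) - B (snd w) (snd z)
    + \<i> * (B (fst w) (snd z) + B (snd w) (fst z))"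


section \<open>Complex manifolds\<close>

type_synonym ('a, 'n) chart = "'a set \<times> ('a \<Rightarrow> complex ^ 'n)"

record ('a, 'n::finite) charted_space =
  top_of :: "'a topology"
  charts :: "('a, 'n) chart set"

abbreviation points :: "('a, 'n::finite) charted_space \<Rightarrow> 'a set"
  where "points X \<equiv> topspace (top_of X)"

abbreviation chart_image :: "('a, 'n::finite) chart \<Rightarrow> (complex ^ 'n) set"
  where "chart_image c \<equiv> snd c ` fst c"

definition chart_point :: "('a, 'n::finite) chart \<Rightarrow> complex ^ 'n \<Rightarrow> 'a"
  where "chart_point c = inv_into (fst c) (snd c)"

definition transition :: "('a, 'n::finite) chart \<Rightarrow> ('a, 'n) chart \<Rightarrow> complex ^ 'n \<Rightarrow> complex ^ 'n"
  where "transition c d = snd d \<circ> chart_point c"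

definition complex_manifold :: "('a, 'n::finite) charted_space \<Rightarrow> bool"
  where "complex_manifold X \<longleftrightarrow>
    Hausdorff_space (top_of X) \<and> second_countable (top_of X) \<and>
    (\<Union>c\<in>charts X. fst c) = points X \<and>
    (\<forall>c\<in>charts X. openin (top_of X) (fst c) \<and> open (chart_image c) \<and>
       homeomorphic_map (subtopology (top_of X) (fst c)) (top_of_set (chart_image c)) (snd c)) \<and>
    (\<forall>c\<in>charts X. \<forall>d\<in>charts X. \<forall>i.
       holomorphic_fun_on (\<lambda>x. transition c d x $ i) (snd c ` (fst c \<inter> fst d)))"

definition charts_at :: "('a, 'n::finite) charted_space \<Rightarrow> 'a \<Rightarrow> ('a, 'n) chart set"
  where "charts_at X p = {c \<in> charts X. p \<in> fst c}"

text \<open>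
  A real tangent vector at \<open>p\<close> is the family of its coordinate representations in the charts
  around \<open>p\<close>, related by the derivatives of the transition maps. All vector space operations are
  pointwise.
\<close>

type_synonym ('a, 'n) tvec = "('a, 'n) chart \<Rightarrow> complex ^ 'n"

definition tangent_space :: "('a, 'n::finite) charted_space \<Rightarrow> 'a \<Rightarrow> ('a, 'n) tvec set"
  where "tangent_space X p = {v.
    (\<forall>c\<in>charts_at X p. \<forall>d\<in>charts_at X p.
       v d = frechet_derivative (transition c d) (at (snd c p)) (v c)) \<and>
    (\<forall>c. c \<notin> charts_at X p \<longrightarrow> v c = 0)}"

definition coord_vector ::
    "('a, 'n::finite) charted_space \<Rightarrow> ('a, 'n) chart \<Rightarrow> 'a \<Rightarrow> complex ^ 'n \<Rightarrow> ('a, 'n) tvec"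
  where "coord_vector X c p e = (\<lambda>d. if d \<in> charts_at X p
    then frechet_derivative (transition c d) (at (snd c p)) e else 0)"

abbreviation cotangent_space ::
    "('a, 'n::finite) charted_space \<Rightarrow> 'a \<Rightarrow> (('a, 'n) tvec \<Rightarrow> real) set"
  where "cotangent_space X p \<equiv> dual_on (*\<^sub>R) (tangent_space X p)"

definition coord_covector ::
    "('a, 'n::finite) charted_space \<Rightarrow> ('a, 'n) chart \<Rightarrow> 'a \<Rightarrow> (complex ^ 'n \<Rightarrow> real)
      \<Rightarrow> ('a, 'n) tvec \<Rightarrow> real"
  where "coord_covector X c p l = restrict0 (tangent_space X p) (\<lambda>v. l (v c))"

definition cplx_structure :: "('a, 'n::finite) tvec \<Rightarrow> ('a, 'n) tvec"
  where "cplx_structure v = (\<lambda>c. \<i> *s v c)"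

type_synonym ('a, 'n) ctvec = "('a, 'n) tvec \<times> ('a, 'n) tvec"

definition complex_tangent_space :: "('a, 'n::finite) charted_space \<Rightarrow> 'a \<Rightarrow> ('a, 'n) ctvec set"
  where "complex_tangent_space X p = tangent_space X p \<times> tangent_space X p"

definition T10 :: "('a, 'n::finite) charted_space \<Rightarrow> 'a \<Rightarrow> ('a, 'n) ctvec set"
  where "T10 X p = {w \<in> complex_tangent_space X p.
    map_prod cplx_structure cplx_structure w = cscale \<i> w}"

definition T01 :: "('a, 'n::finite) charted_space \<Rightarrow> 'a \<Rightarrow> ('a, 'n) ctvec set"
  where "T01 X p = {w \<in> complex_tangent_space X p.
    map_prod cplx_structure cplx_structure w = cscale (- \<i>) w}"

abbreviation T10_dual ::
    "('a, 'n::finite) charted_space \<Rightarrow> 'a \<Rightarrow> (('a, 'n) ctvec \<Rightarrow> complex) set"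
  where "T10_dual X p \<equiv> dual_on cscale (T10 X p)"

text \<open>
  The coordinate fields \<open>\<partial>/\<partial>z\<^sub>i = (\<partial>/\<partial>x\<^sub>i - \<i> \<partial>/\<partial>y\<^sub>i) / 2\<close> and the
  coordinate forms \<open>dz\<^sub>i\<close> (restricted to \<open>T\<^sup>1\<^sup>,\<^sup>0\<close>).
\<close>

definition coord_dbydz ::
    "('a, 'n::finite) charted_space \<Rightarrow> ('a, 'n) chart \<Rightarrow> 'a \<Rightarrow> 'n \<Rightarrow> ('a, 'n) ctvec"
  where "coord_dbydz X c p i =
    ((1/2) *\<^sub>R coord_vector X c p (axis i 1), - ((1/2) *\<^sub>R coord_vector X c p (axis i \<i>)))"

definition coord_dz ::
    "('a, 'n::finite) charted_space \<Rightarrow> ('a, 'n) chart \<Rightarrow> 'a \<Rightarrow> 'n \<Rightarrow> ('a, 'n) ctvec \<Rightarrow> complex"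
  where "coord_dz X c p i = restrict0 (T10 X p) (cext (\<lambda>v. v c $ i))"


section \<open>Two-forms and bivector fields\<close>

text \<open>
  Real- and complex-valued 2-forms are treated uniformly: at each point they are real bilinear
  alternating maps on the real tangent space, the complex-valued ones being identified with their
  complex bilinear extensions to the complexified tangent space.
\<close>

type_synonym ('a, 'n, 'k) form2 = "'a \<Rightarrow> ('a, 'n) tvec \<Rightarrow> ('a, 'n) tvec \<Rightarrow> 'k"

definition form_coeff ::
    "('a, 'n::finite) charted_space \<Rightarrow> ('a, 'n) chart \<Rightarrow> ('a, 'n, 'k) form2
      \<Rightarrow> complex ^ 'n \<Rightarrow> complex ^ 'n \<Rightarrow> complex ^ 'n \<Rightarrow> 'k"
  where "form_coeff X c \<sigma> e f x =
    (let p = chart_point c x in \<sigma> p (coord_vector X c p e) (coord_vector X c p f))"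

definition two_form ::
    "('a, 'n::finite) charted_space \<Rightarrow> ('a, 'n, 'k::real_normed_vector) form2 \<Rightarrow> bool"
  where "two_form X \<sigma> \<longleftrightarrow>
    (\<forall>p\<in>points X. alternating_wrt (*\<^sub>R) (*\<^sub>R) (tangent_space X p) (\<sigma> p)) \<and>
    (\<forall>c\<in>charts X. \<forall>e f. smooth_on (form_coeff X c \<sigma> e f) (chart_image c))"

text \<open>
  The exterior derivative evaluated on three constant coordinate fields, whose Lie brackets vanish.
\<close>

definition closed_form ::
    "('a, 'n::finite) charted_space \<Rightarrow> ('a, 'n, 'k::real_normed_vector) form2 \<Rightarrow> bool"
  where "closed_form X \<sigma> \<longleftrightarrow> (\<forall>c\<in>charts X. \<forall>x\<in>chart_image c. \<forall>e f g.
    frechet_derivative (form_coeff X c \<sigma> f g) (at x) e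
    + frechet_derivative (form_coeff X c \<sigma> g e) (at x) f
    + frechet_derivative (form_coeff X c \<sigma> e f) (at x) g = 0)"

definition real_symplectic_form ::
    "('a, 'n::finite) charted_space \<Rightarrow> ('a, 'n, real) form2 \<Rightarrow> bool"
  where "real_symplectic_form X \<sigma> \<longleftrightarrow> two_form X \<sigma> \<and> closed_form X \<sigma> \<and>
    (\<forall>p\<in>points X. nondegenerate_on (tangent_space X p) (\<sigma> p))"

definition two_zero_form ::
    "('a, 'n::finite) charted_space \<Rightarrow> ('a, 'n, complex) form2 \<Rightarrow> bool"
  where "two_zero_form X \<omega> \<longleftrightarrow> two_form X \<omega> \<and>
    (\<forall>p\<in>points X. \<forall>w\<in>T01 X p. \<forall>z\<in>complex_tangent_space X p. cext2 (\<omega> p) w z = 0)"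

definition holomorphic_two_form ::
    "('a, 'n::finite) charted_space \<Rightarrow> ('a, 'n, complex) form2 \<Rightarrow> bool"
  where "holomorphic_two_form X \<omega> \<longleftrightarrow> two_zero_form X \<omega> \<and>
    (\<forall>c\<in>charts X. \<forall>i j. holomorphic_fun_on
       (\<lambda>x. let p = chart_point c x in cext2 (\<omega> p) (coord_dbydz X c p i) (coord_dbydz X c p j))
       (chart_image c))"

definition holomorphic_symplectic_form ::
    "('a, 'n::finite) charted_space \<Rightarrow> ('a, 'n, complex) form2 \<Rightarrow> bool"
  where "holomorphic_symplectic_form X \<omega> \<longleftrightarrow> holomorphic_two_form X \<omega> \<and> closed_form X \<omega> \<and>
    (\<forall>p\<in>points X. nondegenerate_on (T10 X p) (cext2 (\<omega> p)))"

definition Re_form :: "('a, 'n::finite, complex) form2 \<Rightarrow> ('a, 'n, real) form2"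
  where "Re_form \<omega> = (\<lambda>p u v. Re (\<omega> p u v))"

definition Im_form :: "('a, 'n::finite, complex) form2 \<Rightarrow> ('a, 'n, real) form2"
  where "Im_form \<omega> = (\<lambda>p u v. Im (\<omega> p u v))"

type_synonym ('a, 'n) bivec =
  "'a \<Rightarrow> (('a, 'n) tvec \<Rightarrow> real) \<Rightarrow> (('a, 'n) tvec \<Rightarrow> real) \<Rightarrow> real"

definition bivector_field :: "('a, 'n::finite) charted_space \<Rightarrow> ('a, 'n) bivec \<Rightarrow> bool"
  where "bivector_field X P \<longleftrightarrow>
    (\<forall>p\<in>points X. alternating_wrt (*\<^sub>R) (*\<^sub>R) (cotangent_space X p) (P p)) \<and>
    (\<forall>c\<in>charts X. \<forall>l m. linear l \<longrightarrow> linear m \<longrightarrow> smooth_on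
       (\<lambda>x. let p = chart_point c x in P p (coord_covector X c p l) (coord_covector X c p m))
       (chart_image c))"

text \<open>Sections of the second exterior power of \<open>T\<^sup>1\<^sup>,\<^sup>0\<close>.\<close>

type_synonym ('a, 'n) bivec10 =
  "'a \<Rightarrow> (('a, 'n) ctvec \<Rightarrow> complex) \<Rightarrow> (('a, 'n) ctvec \<Rightarrow> complex) \<Rightarrow> complex"

definition holomorphic_bivector_field ::
    "('a, 'n::finite) charted_space \<Rightarrow> ('a, 'n) bivec10 \<Rightarrow> bool"
  where "holomorphic_bivector_field X \<pi> \<longleftrightarrow>
    (\<forall>p\<in>points X. alternating_wrt (\<lambda>a \<alpha> w. a * \<alpha> w) (*) (T10_dual X p) (\<pi> p)) \<and>
    (\<forall>c\<in>charts X. \<forall>i j. holomorphic_fun_on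
       (\<lambda>x. let p = chart_point c x in \<pi> p (coord_dz X c p i) (coord_dz X c p j))
       (chart_image c))"

text \<open>
  The image of a section of the second exterior power of \<open>T\<^sup>1\<^sup>,\<^sup>0\<close> in that of the
  complexified tangent bundle, evaluated on two real covectors: they are extended complex linearly
  to the complexified tangent space and pulled back along the inclusion of \<open>T\<^sup>1\<^sup>,\<^sup>0\<close>.
\<close>

definition covector10 ::
    "('a, 'n::finite) charted_space \<Rightarrow> 'a \<Rightarrow> (('a, 'n) tvec \<Rightarrow> real) \<Rightarrow> ('a, 'n) ctvec \<Rightarrow> complex"
  where "covector10 X p \<alpha> = restrict0 (T10 X p) (cext (\<lambda>v. complex_of_real (\<alpha> v)))"

definition Re_bivector ::
    "('a, 'n::finite) charted_space \<Rightarrow> ('a, 'n) bivec10 \<Rightarrow> ('a, 'n) bivec"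
  where "Re_bivector X \<pi> = (\<lambda>p \<alpha> \<beta>. Re (\<pi> p (covector10 X p \<alpha>) (covector10 X p \<beta>)))"

definition Im_bivector ::
    "('a, 'n::finite) charted_space \<Rightarrow> ('a, 'n) bivec10 \<Rightarrow> ('a, 'n) bivec"
  where "Im_bivector X \<pi> = (\<lambda>p \<alpha> \<beta>. Im (\<pi> p (covector10 X p \<alpha>) (covector10 X p \<beta>)))"


section \<open>The Poisson bivector field of a symplectic form\<close>

definition poisson_bivector_of ::
    "('a, 'n::finite) charted_space \<Rightarrow> ('a, 'n, real) form2 \<Rightarrow> ('a, 'n) bivec \<Rightarrow> bool"
  where "poisson_bivector_of X \<sigma> P \<longleftrightarrow> real_symplectic_form X \<sigma> \<and> bivector_field X P \<and>
    (\<forall>p\<in>points X.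
       sharp_inverse_flat (tangent_space X p) (cotangent_space X p) (\<sigma> p) (P p))"

definition holomorphic_poisson_bivector_of ::
    "('a, 'n::finite) charted_space \<Rightarrow> ('a, 'n, complex) form2 \<Rightarrow> ('a, 'n) bivec10 \<Rightarrow> bool"
  where "holomorphic_poisson_bivector_of X \<omega> \<pi> \<longleftrightarrow>
    holomorphic_symplectic_form X \<omega> \<and> holomorphic_bivector_field X \<pi> \<and>
    (\<forall>p\<in>points X. sharp_inverse_flat (T10 X p) (T10_dual X p) (cext2 (\<omega> p)) (\<pi> p))"

end

theory Submission
  imports Defs
begin

text \<open>
  The statement is pointwise linear algebra on the real tangent space \<open>T\<close> with its complex
  structure \<open>J\<close>, plus regularity.

  The space of vectors of type (1,0) is the graph \<open>{u - \<i> J u | u \<in> T}\<close>, and a (2,0)-form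
  \<open>\<omega>\<close> is complex bilinear on \<open>(T, J)\<close> (\<open>two_zero_form_cplx_scale\<close>), so that
  \<open>\<omega>(u - \<i> J u, v - \<i> J v) = 4 \<omega>(u, v)\<close> (\<open>cext2_type10\<close>). This is the source of the factor 4.
  A real covector \<open>\<alpha>\<close> pulls back to the (1,0)-covector \<open>u - \<i> J u \<mapsto> \<alpha>(u) - \<i> \<alpha>(J u)\<close>, whose
  real part is \<open>\<alpha>\<close>. If \<open>u - \<i> J u\<close> is the vector that \<open>\<omega>\<^sup>\<flat>\<close> maps to this covector, then
  \<open>4 \<omega>(u, v) = \<alpha>(v) - \<i> \<alpha>(J v)\<close> and \<open>\<pi>(\<alpha>, \<beta>) = \<beta>(u) - \<i> \<beta>(J u)\<close>. Taking real parts of the two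
  equations gives \<open>\<omega>\<^sub>R(4 u, \<cdot>) = \<alpha>\<close> and \<open>4 \<pi>\<^sub>R(\<alpha>, \<beta>) = \<beta>(4 u)\<close>, which is the claim for \<open>\<omega>\<^sub>R\<close>.

  For \<open>\<omega>\<^sub>I\<close> one observes that \<open>a \<omega>\<close> has the Poisson bivector \<open>\<pi> / a\<close> for every complex
  \<open>a \<noteq> 0\<close>, and that \<open>\<omega>\<^sub>I = Re (- \<i> \<omega>)\<close> while \<open>Re (\<pi> / (- \<i>)) = - \<pi>\<^sub>I\<close>. Hence
  \<open>poisson_bivector_of_Re_mult\<close> treats \<open>Re (a \<omega>)\<close> and \<open>4 Re (\<pi> / a)\<close> for arbitrary \<open>a \<noteq> 0\<close>,
  and both claims are instances.

  The sharp map is a definite description, so its value has to be shown to exist and to be unique.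
  No dimensions are counted for this. By nondegeneracy, the covectors \<open>B(w, \<cdot>)\<close> already separate
  vectors (\<open>flat_covectors_separate\<close>). If the flat map is bijective, then every covector has this
  form, and a linear functional on covectors is a covector \<open>B(z, \<cdot>)\<close> in the variable \<open>w\<close>, that is,
  evaluation
  at \<open>- z\<close> (\<open>sharp_inverse_flatD\<close>). Likewise the flat map of \<open>\<omega>\<^sub>R\<close> is onto because that
  of \<open>\<omega>\<close> is. The bivector field is smooth because pullbacks of the constant real
  covectors of a chart are constant combinations of the forms \<open>dz\<^sub>k\<close>
  (\<open>covector10_coord_covector\<close>).
\<close>

section \<open>Smooth functions\<close>

text \<open>
  Derivatives are taken in the whole space, so values on \<open>S\<close> determine them only when \<open>S\<close> is
  open.
\<close>

lemma Ck_on_cong: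
  assumes "open S" "Ck_on k f S" "\<And>x. x \<in> S \<Longrightarrow> f x = g x"
  shows "Ck_on k g S"
  using assms(2,3)
proof (induction k arbitrary: f g)
  case 0
  then show ?case
    using continuous_on_cong[of S S f g] by auto
next
  case (Suc k)
  have d: "f differentiable at x" if "x \<in> S" for x
    using Suc.prems that by auto
  have D: "frechet_derivative f (at x) = frechet_derivative g (at x)" if "x \<in> S" for x
    using frechet_derivative_transform_within_open[OF d \<open>open S\<close> that] Suc.prems(2) that by blast
  have "g differentiable at x" if "x \<in> S" for x
    using d[OF that] has_derivative_transform_within_open[OF _ \<open>open S\<close> that, of f _ UNIV g]
      Suc.prems(2) unfolding differentiable_def by blast
  moreover have "Ck_on k (\<lambda>x. frechet_derivative g (at x) v) S" for v
    by (rule Suc.IH[of "\<lambda>x. frechet_derivative f (at x) v"]) (use Suc.prems(1) D in auto)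
  ultimately show ?case
    by simp
qed

lemma smooth_on_cong:
  assumes "open S" "smooth_on f S" "\<And>x. x \<in> S \<Longrightarrow> f x = g x"
  shows "smooth_on g S"
  unfolding smooth_on_def
proof
  fix k
  have "Ck_on k f S"
    using assms(2) unfolding smooth_on_def by (rule spec)
  then show "Ck_on k g S"
    by (rule Ck_on_cong[OF assms(1) _ assms(3)])
qed

lemma frechet_derivative_bounded_linear:
  assumes "bounded_linear h" "f differentiable at x"
  shows "frechet_derivative (\<lambda>x. h (f x)) (at x) v = h (frechet_derivative f (at x) v)"
proof -
  have "((\<lambda>x. h (f x)) has_derivative (\<lambda>v. h (frechet_derivative f (at x) v))) (at x)"
    using bounded_linear.has_derivative[OF assms(1)] assms(2) frechet_derivative_works by blast
  then show ?thesis
    by (metis frechet_derivative_at)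
qed

lemma smooth_on_bounded_linear:
  assumes "open S" "bounded_linear h" "smooth_on f S"
  shows "smooth_on (\<lambda>x. h (f x)) S"
proof -
  have "Ck_on k (\<lambda>x. h (f x)) S" if "Ck_on k f S" for k
    using that
  proof (induction k arbitrary: f)
    case 0
    then show ?case
      using bounded_linear.continuous_on[OF assms(2)] by auto
  next
    case (Suc k)
    have d: "f differentiable at x" if "x \<in> S" for x
      using Suc.prems that by auto
    have "(\<lambda>x. h (f x)) differentiable at x" if "x \<in> S" for x
      using d[OF that] bounded_linear.has_derivative[OF assms(2)] unfolding differentiable_def
      by blast
    moreover have "Ck_on k (\<lambda>x. frechet_derivative (\<lambda>x. h (f x)) (at x) v) S" for v
      by (rule Ck_on_cong[OF assms(1) Suc.IH[of "\<lambda>x. frechet_derivative f (at x) v"]])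
        (use Suc.prems d in \<open>auto simp: frechet_derivative_bounded_linear[OF assms(2)]\<close>)
    ultimately show ?case
      by simp
  qed
  then show ?thesis
    using assms(3) unfolding smooth_on_def by blast
qed

lemma smooth_on_zero: "smooth_on (\<lambda>x. 0) S"
proof -
  have "Ck_on k (\<lambda>x. 0) S" for k
    by (induction k) auto
  then show ?thesis
    unfolding smooth_on_def by blast
qed

lemma smooth_on_add:
  assumes "open S" "smooth_on f S" "smooth_on g S"
  shows "smooth_on (\<lambda>x. f x + g x) S"
proof -
  have "Ck_on k (\<lambda>x. f x + g x) S" if "Ck_on k f S" "Ck_on k g S" for k
    using that
  proof (induction k arbitrary: f g)
    case 0
    then show ?case
      by (auto intro: continuous_on_add)
  next
    case (Suc k)
    have d: "f differentiable at x" "g differentiable at x" if "x \<in> S" for x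
      using Suc.prems that by auto
    have D: "((\<lambda>x. f x + g x) has_derivative
        (\<lambda>v. frechet_derivative f (at x) v + frechet_derivative g (at x) v)) (at x)"
      if "x \<in> S" for x
      using d[OF that] has_derivative_add frechet_derivative_works by blast
    have sum: "frechet_derivative (\<lambda>x. f x + g x) (at x) v
        = frechet_derivative f (at x) v + frechet_derivative g (at x) v" if "x \<in> S" for x v
      by (metis frechet_derivative_at[OF D[OF that]])
    have "Ck_on k (\<lambda>x. frechet_derivative (\<lambda>x. f x + g x) (at x) v) S" for v
      by (rule Ck_on_cong[OF assms(1) Suc.IH[of "\<lambda>x. frechet_derivative f (at x) v"
            "\<lambda>x. frechet_derivative g (at x) v"]])
        (use Suc.prems sum in auto)
    with D show ?case
      unfolding Ck_on.simps differentiable_def by blast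
  qed
  then show ?thesis
    using assms(2,3) unfolding smooth_on_def by blast
qed

lemma smooth_on_sum:
  assumes "open S" "finite I" "\<And>i. i \<in> I \<Longrightarrow> smooth_on (f i) S"
  shows "smooth_on (\<lambda>x. \<Sum>i\<in>I. f i x) S"
  using assms(2,3)
  by (induction I rule: finite_induct) (simp_all add: smooth_on_zero smooth_on_add[OF assms(1)])


section \<open>Nondegenerate alternating forms\<close>

lemma alternating_wrt_skew:
  fixes V :: "'v::ab_group_add set" and B :: "'v \<Rightarrow> 'v \<Rightarrow> 'w::ab_group_add"
  assumes alt: "alternating_wrt s t V B" and add: "\<And>u v. u \<in> V \<Longrightarrow> v \<in> V \<Longrightarrow> u + v \<in> V"
    and "u \<in> V" "v \<in> V"
  shows "B v u = - B u v"
proof -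
  note alt = alt[unfolded alternating_wrt_def linear_wrt_def]
  have "0 = B (u + v) (u + v)"
    using alt add assms(3,4) by metis
  also have "\<dots> = B u (u + v) + B v (u + v)"
    using alt add assms(3,4) by metis
  also have "\<dots> = (B u u + B u v) + (B v u + B v v)"
    using alt add assms(3,4) by metis
  also have "\<dots> = B u v + B v u"
    using alt assms(3,4) by simp
  finally show ?thesis
    by (metis add_eq_0_iff)
qed

lemma flat_in_dual_on:
  fixes s :: "'k::field \<Rightarrow> 'v::ab_group_add \<Rightarrow> 'v"
  assumes "vector_space s" "module.subspace s V" "alternating_wrt s (*) V B" "u \<in> V"
  shows "flat V B u \<in> dual_on s V"
proof -
  interpret vector_space s by fact
  show ?thesis
    using assms(2-4)
    by (auto simp: dual_on_def flat_def restrict0_def alternating_wrt_def linear_wrt_def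
        subspace_def)
qed

text \<open>
  In terms of \<open>B\<close>, the assumption is \<open>B(w, u - v) = 0\<close> for all \<open>w\<close>; skew symmetry turns it into
  the degeneracy condition for \<open>u - v\<close>. This gives the uniqueness needed for the sharp map.
\<close>

lemma flat_covectors_separate:
  fixes s :: "'k::field \<Rightarrow> 'v::ab_group_add \<Rightarrow> 'v"
  assumes "vector_space s" "module.subspace s V" "alternating_wrt s (*) V B"
    "nondegenerate_on V B" and uv: "u \<in> V" "v \<in> V" "\<And>w. w \<in> V \<Longrightarrow> flat V B w u = flat V B w v"
  shows "u = v"
proof -
  interpret vector_space s by fact
  have uv': "u - v \<in> V"
    using assms(2) uv(1,2) by (rule subspace_diff)
  have lin: "B w (u - v + v) = B w (u - v) + B w v" if "w \<in> V" for w
    using assms(3) that uv(2) uv' unfolding alternating_wrt_def linear_wrt_def by blast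
  have "B (u - v) w = 0" if "w \<in> V" for w
  proof -
    have "B (u - v) w = - B w (u - v)"
      using alternating_wrt_skew[OF assms(3) subspace_add[OF assms(2)] that uv'] .
    also have "\<dots> = 0"
      using lin[OF that] uv(3)[OF that] uv(1,2) by (simp add: flat_def restrict0_def)
    finally show ?thesis .
  qed
  then show ?thesis
    using assms(4) uv' unfolding nondegenerate_on_def by fastforce
qed

lemma inj_on_flat:
  fixes s :: "'k::field \<Rightarrow> 'v::ab_group_add \<Rightarrow> 'v"
  assumes "vector_space s" "module.subspace s V" "alternating_wrt s (*) V B" "nondegenerate_on V B"
  shows "inj_on (flat V B) V"
proof (rule inj_onI)
  interpret vector_space s by fact
  fix u v
  assume uv: "u \<in> V" "v \<in> V" "flat V B u = flat V B v"
  have "flat V B w u = flat V B w v" if "w \<in> V" for w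
  proof -
    have "B u w = B v w"
      using fun_cong[OF uv(3), of w] that by (simp add: flat_def restrict0_def)
    then have "B w u = B w v"
      using alternating_wrt_skew[OF assms(3) subspace_add[OF assms(2)]] that uv(1,2) by metis
    then show ?thesis
      using uv(1,2) by (simp add: flat_def restrict0_def)
  qed
  with uv(1,2) show "u = v"
    using flat_covectors_separate[OF assms] by blast
qed

lemma sharp_eqI:
  fixes s :: "'k::field \<Rightarrow> 'v::ab_group_add \<Rightarrow> 'v"
  assumes V: "vector_space s" "module.subspace s V" "alternating_wrt s (*) V B"
    "nondegenerate_on V B"
    and v: "v \<in> V" "\<And>\<beta>. \<beta> \<in> dual_on s V \<Longrightarrow> \<beta> v = P \<alpha> \<beta>"
  shows "sharp V (dual_on s V) P \<alpha> = v"
  unfolding sharp_def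
proof (rule the_equality)
  show "v \<in> V \<and> (\<forall>\<beta>\<in>dual_on s V. \<beta> v = P \<alpha> \<beta>)"
    using v by blast
next
  fix u
  assume u: "u \<in> V \<and> (\<forall>\<beta>\<in>dual_on s V. \<beta> u = P \<alpha> \<beta>)"
  show "u = v"
    by (rule flat_covectors_separate[OF V]) (use u v flat_in_dual_on[OF V(1-3)] in auto)
qed

text \<open>
  It suffices to exhibit, for each covector, one vector that is both its preimage under the flat map
  and its image under the sharp map; nondegeneracy makes both unique.
\<close>

lemma sharp_inverse_flatI:
  fixes s :: "'k::field \<Rightarrow> 'v::ab_group_add \<Rightarrow> 'v"
  assumes V: "vector_space s" "module.subspace s V" "alternating_wrt s (*) V B"
    "nondegenerate_on V B"
    and rep: "\<And>\<alpha>. \<alpha> \<in> dual_on s V \<Longrightarrow>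
      \<exists>v\<in>V. flat V B v = \<alpha> \<and> (\<forall>\<beta>\<in>dual_on s V. \<beta> v = P \<alpha> \<beta>)"
  shows "sharp_inverse_flat V (dual_on s V) B P"
proof -
  have inj: "inj_on (flat V B) V"
    by (rule inj_on_flat[OF V])
  have "flat V B ` V = dual_on s V"
  proof
    show "flat V B ` V \<subseteq> dual_on s V"
      using flat_in_dual_on[OF V(1-3)] by blast
    show "dual_on s V \<subseteq> flat V B ` V"
      using rep by blast
  qed
  moreover have "sharp V (dual_on s V) P \<alpha> = inv_into V (flat V B) \<alpha>" if "\<alpha> \<in> dual_on s V" for \<alpha>
  proof -
    obtain v where v: "v \<in> V" "flat V B v = \<alpha>" "\<forall>\<beta>\<in>dual_on s V. \<beta> v = P \<alpha> \<beta>"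
      using rep \<open>\<alpha> \<in> dual_on s V\<close> by blast
    have "sharp V (dual_on s V) P \<alpha> = v"
      by (rule sharp_eqI[OF V]) (use v in auto)
    also have "v = inv_into V (flat V B) \<alpha>"
      using inv_into_f_f[OF inj v(1)] v(2) by simp
    finally show ?thesis .
  qed
  ultimately show ?thesis
    using inj unfolding sharp_inverse_flat_def bij_betw_def by blast
qed

text \<open>
  The definite description in the sharp map may be unfolded because a representing vector exists:
  \<open>w \<mapsto> P(\<alpha>, B(w, \<cdot>))\<close> is a covector, hence equals \<open>B(z, \<cdot>)\<close> for some \<open>z\<close>, and
  \<open>B(z, w) = B(w, - z)\<close> is the value of \<open>B(w, \<cdot>)\<close> at \<open>- z\<close>.
\<close>

lemma sharp_inverse_flatD:
  fixes s :: "'k::field \<Rightarrow> 'v::ab_group_add \<Rightarrow> 'v"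
  assumes V: "vector_space s" "module.subspace s V" "alternating_wrt s (*) V B"
    "nondegenerate_on V B"
    and inv: "sharp_inverse_flat V (dual_on s V) B P"
    and lin: "linear_wrt (\<lambda>a \<alpha> w. a * \<alpha> w) (*) (dual_on s V) (P \<alpha>)"
    and \<alpha>: "\<alpha> \<in> dual_on s V"
  obtains v where "v \<in> V" "flat V B v = \<alpha>" "\<And>\<beta>. \<beta> \<in> dual_on s V \<Longrightarrow> \<beta> v = P \<alpha> \<beta>"
proof -
  interpret vector_space s by fact
  note alt = V(3)[unfolded alternating_wrt_def linear_wrt_def]
  have bij: "bij_betw (flat V B) V (dual_on s V)"
    and sh: "sharp V (dual_on s V) P \<alpha> = inv_into V (flat V B) \<alpha>"
    using inv \<alpha> unfolding sharp_inverse_flat_def by auto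
  let ?F = "restrict0 V (\<lambda>w. P \<alpha> (flat V B w))"
  have add: "flat V B (u + v) = flat V B u + flat V B v" if "u \<in> V" "v \<in> V" for u v
    using alt that by (auto simp: flat_def restrict0_def fun_eq_iff)
  have scl: "flat V B (s a u) = (\<lambda>w. a * flat V B u w)" if "u \<in> V" for a u
    using alt that by (auto simp: flat_def restrict0_def fun_eq_iff)
  have "linear_wrt s (*) V ?F"
    using lin V(2) flat_in_dual_on[OF V(1-3)]
    unfolding linear_wrt_def by (simp add: restrict0_def add scl subspace_add subspace_scale)
  then have "?F \<in> dual_on s V"
    by (simp add: dual_on_def restrict0_def)
  then obtain z where z: "z \<in> V" "flat V B z = ?F"
    using bij_betw_imp_surj_on[OF bij] by (metis imageE)
  have *: "\<beta> (- z) = P \<alpha> \<beta>" if "\<beta> \<in> dual_on s V" for \<beta>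
  proof -
    obtain w where w: "\<beta> = flat V B w" "w \<in> V"
      using \<open>\<beta> \<in> dual_on s V\<close> unfolding bij_betw_imp_surj_on[OF bij, symmetric]
      by (rule imageE)
    have mz: "- z \<in> V"
      using subspace_neg[OF V(2) z(1)] .
    have "\<beta> (- z) = B w (- z)"
      using w mz by (simp add: flat_def restrict0_def)
    also have "\<dots> = - B w z"
      using alt[THEN conjunct1, rule_format, OF w(2), THEN conjunct2, rule_format, of z "- 1"] z(1)
      by simp
    also have "\<dots> = B z w"
      using alternating_wrt_skew[OF V(3) subspace_add[OF V(2)] w(2) z(1)] by simp
    also have "\<dots> = P \<alpha> \<beta>"
      using fun_cong[OF z(2), of w] w by (simp add: flat_def restrict0_def)
    finally show ?thesis .
  qed
  have mz: "- z \<in> V"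
    using subspace_neg[OF V(2) z(1)] .
  have "inv_into V (flat V B) \<alpha> = - z"
    unfolding sh[symmetric] by (rule sharp_eqI[OF V mz]) (rule *)
  then have "flat V B (- z) = \<alpha>"
    using bij_betw_inv_into_right[OF bij \<alpha>] by simp
  with mz * show ?thesis
    using that by blast
qed


section \<open>The complexified tangent space\<close>

lemma vector_space_cscale: "vector_space (cscale :: complex \<Rightarrow> 'v \<times> 'v \<Rightarrow> 'v \<times> 'v::real_vector)"
  by unfold_locales (auto simp: cscale_def algebra_simps prod_eq_iff)

lemma vector_space_scaleR: "vector_space ((*\<^sub>R) :: real \<Rightarrow> 'v \<Rightarrow> 'v::real_vector)"
  by unfold_locales (auto simp: algebra_simps)

lemma chart_point_in_points:
  assumes "complex_manifold X" "c \<in> charts X" "x \<in> chart_image c"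
  shows "chart_point c x \<in> points X"
proof -
  have "chart_point c x \<in> fst c"
    unfolding chart_point_def using assms(3) by (rule inv_into_into)
  then show ?thesis
    using assms(1,2) unfolding complex_manifold_def by blast
qed

text \<open>
  Holomorphy is given for the components of a transition map, so its derivative is assembled
  from the derivatives of the components.
\<close>

lemma complex_linear_transition_derivative:
  assumes "complex_manifold X" "c \<in> charts_at X p" "d \<in> charts_at X p"
  shows "linear (frechet_derivative (transition c d) (at (snd c p)))"
    and "frechet_derivative (transition c d) (at (snd c p)) (a *s v)
      = a *s frechet_derivative (transition c d) (at (snd c p)) v"
proof -
  let ?q = "snd c p"
  let ?g = "\<lambda>i x. transition c d x $ i"
  have hol: "holomorphic_fun_on (?g i) (snd c ` (fst c \<inter> fst d))" for i
    using assms unfolding complex_manifold_def charts_at_def by blast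
  have q: "?q \<in> snd c ` (fst c \<inter> fst d)"
    using assms(2,3) unfolding charts_at_def by blast
  have "Ck_on 1 (?g i) (snd c ` (fst c \<inter> fst d))" for i
    using hol unfolding holomorphic_fun_on_def smooth_on_def by blast
  then have g: "(?g i has_derivative frechet_derivative (?g i) (at ?q)) (at ?q)" for i
    using q frechet_derivative_works by auto blast
  let ?D = "\<lambda>v. \<chi> i. frechet_derivative (?g i) (at ?q) v"
  have D: "(transition c d has_derivative ?D) (at ?q)"
  proof (subst has_derivative_componentwise_within, rule ballI)
    fix b :: "complex ^ 'b"
    assume "b \<in> Basis"
    then obtain i z where b: "b = axis i z"
      by (auto simp: Basis_vec_def)
    show "((\<lambda>x. transition c d x \<bullet> b) has_derivative (\<lambda>v. ?D v \<bullet> b)) (at ?q)"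
      using has_derivative_inner_left[OF g] by (simp add: b inner_axis)
  qed
  then show "linear (frechet_derivative (transition c d) (at ?q))"
    unfolding frechet_derivative_at[OF D, symmetric] using has_derivative_linear[OF D] by simp
  have "frechet_derivative (?g i) (at ?q) (a *s v) = a * frechet_derivative (?g i) (at ?q) v" for i
    using hol q unfolding holomorphic_fun_on_def by blast
  then show "frechet_derivative (transition c d) (at ?q) (a *s v)
      = a *s frechet_derivative (transition c d) (at ?q) v"
    unfolding frechet_derivative_at[OF D, symmetric] by (simp add: vec_eq_iff)
qed

lemma subspace_tangent_space:
  assumes "complex_manifold X"
  shows "subspace (tangent_space X p)"
proof (rule subspaceI)
  note lin = complex_linear_transition_derivative(1)[OF assms]
  show "0 \<in> tangent_space X p"
    by (simp add: tangent_space_def linear_0[OF lin])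
  have coord: "v d = frechet_derivative (transition c d) (at (snd c p)) (v c)"
    if "v \<in> tangent_space X p" "c \<in> charts_at X p" "d \<in> charts_at X p" for v c d
    using that unfolding tangent_space_def by blast
  have zero: "v c = 0" if "v \<in> tangent_space X p" "c \<notin> charts_at X p" for v c
    using that unfolding tangent_space_def by blast
  show "u + v \<in> tangent_space X p"
    if uv: "u \<in> tangent_space X p" "v \<in> tangent_space X p" for u v
    unfolding tangent_space_def mem_Collect_eq
  proof (intro conjI ballI allI impI)
    fix c d
    assume cd: "c \<in> charts_at X p" "d \<in> charts_at X p"
    show "(u + v) d = frechet_derivative (transition c d) (at (snd c p)) ((u + v) c)"
      by (simp add: linear_add[OF lin[OF cd]] coord[OF uv(1) cd] coord[OF uv(2) cd])
  qed (simp add: zero uv)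
  show "r *\<^sub>R v \<in> tangent_space X p" if v: "v \<in> tangent_space X p" for r v
    unfolding tangent_space_def mem_Collect_eq
  proof (intro conjI ballI allI impI)
    fix c d
    assume cd: "c \<in> charts_at X p" "d \<in> charts_at X p"
    show "(r *\<^sub>R v) d = frechet_derivative (transition c d) (at (snd c p)) ((r *\<^sub>R v) c)"
      by (simp add: scaleR_fun_def linear_scale[OF lin[OF cd]] coord[OF v cd])
  qed (simp add: zero v scaleR_fun_def)
qed

definition cplx_scale :: "complex \<Rightarrow> ('a, 'n::finite) tvec \<Rightarrow> ('a, 'n) tvec"
  where "cplx_scale a v = (\<lambda>c. a *s v c)"

lemma cplx_structure_eq_cplx_scale: "cplx_structure = cplx_scale \<i>"
  by (simp add: cplx_structure_def cplx_scale_def fun_eq_iff)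

lemma cplx_scale_conv_cplx_structure:
  "cplx_scale a u = Re a *\<^sub>R u + Im a *\<^sub>R cplx_structure u"
  by (simp add: cplx_structure_def cplx_scale_def fun_eq_iff vec_eq_iff scaleR_fun_def
      complex_eq_iff)

lemma cplx_structure_cplx_scale:
  "cplx_structure (cplx_scale a u) = Re a *\<^sub>R cplx_structure u + Im a *\<^sub>R (- u)"
  by (simp add: cplx_structure_def cplx_scale_def fun_eq_iff vec_eq_iff scaleR_fun_def
      complex_eq_iff)

lemma cplx_scale_in_tangent_space:
  assumes "complex_manifold X" "u \<in> tangent_space X p"
  shows "cplx_scale a u \<in> tangent_space X p"
  unfolding tangent_space_def mem_Collect_eq
proof (intro conjI ballI allI impI)
  fix c d
  assume cd: "c \<in> charts_at X p" "d \<in> charts_at X p"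
  then have "u d = frechet_derivative (transition c d) (at (snd c p)) (u c)"
    using assms(2) unfolding tangent_space_def by blast
  then show "cplx_scale a u d = frechet_derivative (transition c d) (at (snd c p)) (cplx_scale a u c)"
    by (simp only: cplx_scale_def complex_linear_transition_derivative(2)[OF assms(1) cd])
next
  fix c
  assume "c \<notin> charts_at X p"
  then show "cplx_scale a u c = 0"
    using assms(2) unfolding tangent_space_def cplx_scale_def by (cases c) simp
qed

lemma cplx_structure_in_tangent_space:
  assumes "complex_manifold X" "u \<in> tangent_space X p"
  shows "cplx_structure u \<in> tangent_space X p"
  using cplx_scale_in_tangent_space[OF assms] by (simp add: cplx_structure_eq_cplx_scale)

text \<open>
  The vector \<open>u - \<i> J u\<close>, twice the (1,0)-part of \<open>u\<close>. It makes \<open>(T, J)\<close> isomorphic to the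
  space of (1,0)-vectors as a complex vector space, and its first component recovers \<open>u\<close>.
\<close>

definition type10 :: "('a, 'n::finite) tvec \<Rightarrow> ('a, 'n) ctvec"
  where "type10 u = (u, - cplx_structure u)"

lemma type10_add: "type10 (u + v) = type10 u + type10 v"
  by (simp add: type10_def cplx_structure_def fun_eq_iff vec_eq_iff algebra_simps)

lemma type10_cplx_scale: "type10 (cplx_scale a u) = cscale a (type10 u)"
  by (simp add: type10_def cscale_def cplx_structure_def cplx_scale_def fun_eq_iff vec_eq_iff
      scaleR_fun_def complex_eq_iff)

text \<open>
  For \<open>(u, v)\<close>, standing for \<open>u + \<i> v\<close>, the condition \<open>J (u + \<i> v) = \<i> (u + \<i> v)\<close>
  amounts to \<open>v = - J u\<close>. That the image lies in the tangent space needs \<open>J\<close> to preserve it, which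
  is the complex linearity of the transition derivatives.
\<close>

lemma T10_eq_type10_image:
  assumes "complex_manifold X"
  shows "T10 X p = type10 ` tangent_space X p"
proof
  show "T10 X p \<subseteq> type10 ` tangent_space X p"
  proof
    fix w
    assume "w \<in> T10 X p"
    then have w: "fst w \<in> tangent_space X p" "cplx_structure (fst w) = - snd w"
      by (auto simp: T10_def complex_tangent_space_def cscale_def)
    then have "w = type10 (fst w)"
      by (simp add: type10_def prod_eq_iff)
    with w(1) show "w \<in> type10 ` tangent_space X p"
      by blast
  qed
  show "type10 ` tangent_space X p \<subseteq> T10 X p"
    using cplx_structure_in_tangent_space[OF assms]
      subspace_neg[OF subspace_tangent_space[OF assms]]
    by (auto simp: T10_def complex_tangent_space_def cscale_def type10_def
        cplx_structure_def fun_eq_iff vec_eq_iff)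
qed

lemma type10_zero: "type10 0 = 0"
  by (simp add: type10_def cplx_structure_def fun_eq_iff vec_eq_iff zero_prod_def)

lemma subspace_T10:
  fixes X :: "('a, 'n::finite) charted_space"
  assumes "complex_manifold X"
  shows "module.subspace cscale (T10 X p)"
proof -
  interpret C: vector_space "cscale :: complex \<Rightarrow> ('a, 'n) ctvec \<Rightarrow> ('a, 'n) ctvec"
    by (rule vector_space_cscale)
  note T = subspace_tangent_space[OF assms, of p]
  show ?thesis
    unfolding T10_eq_type10_image[OF assms]
  proof (rule C.subspaceI)
    show "0 \<in> type10 ` tangent_space X p"
      using subspace_0[OF T] type10_zero by (metis imageI)
    show "w + z \<in> type10 ` tangent_space X p"
      if "w \<in> type10 ` tangent_space X p" "z \<in> type10 ` tangent_space X p" for w z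
      using that subspace_add[OF T] type10_add by (metis (no_types, lifting) image_iff)
    show "cscale a w \<in> type10 ` tangent_space X p" if "w \<in> type10 ` tangent_space X p" for a w
      using that cplx_scale_in_tangent_space[OF assms] type10_cplx_scale
      by (metis (no_types, lifting) image_iff)
  qed
qed


section \<open>Forms of type (2,0)\<close>

text \<open>
  The vector \<open>u + \<i> J u\<close> is of type (0,1), so pairing it with the real vector \<open>v\<close> gives
  \<open>\<omega>(u, v) + \<i> \<omega>(J u, v) = 0\<close>.
\<close>

lemma two_zero_form_cplx_structure:
  assumes X: "complex_manifold X" and \<omega>: "two_zero_form X \<omega>" and p: "p \<in> points X"
    and uv: "u \<in> tangent_space X p" "v \<in> tangent_space X p"
  shows "\<omega> p (cplx_structure u) v = \<i> * \<omega> p u v"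
proof -
  note T = subspace_tangent_space[OF X, of p]
  note J = cplx_structure_in_tangent_space[OF X]
  have alt: "alternating_wrt (*\<^sub>R) (*\<^sub>R) (tangent_space X p) (\<omega> p)"
    using \<omega> p unfolding two_zero_form_def two_form_def by blast
  have zero: "\<omega> p u 0 = 0" if "u \<in> tangent_space X p" for u
    using alt that subspace_0[OF T] unfolding alternating_wrt_def linear_wrt_def
    by (metis scaleR_zero_left)
  have "(u, cplx_structure u) \<in> T01 X p"
    using uv(1) J[OF uv(1)]
    by (auto simp: T01_def complex_tangent_space_def cscale_def cplx_structure_def fun_eq_iff
        vec_eq_iff)
  moreover have "(v, 0) \<in> complex_tangent_space X p"
    using uv(2) subspace_0[OF T] by (simp add: complex_tangent_space_def)
  ultimately have "cext2 (\<omega> p) (u, cplx_structure u) (v, 0) = 0"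
    using \<omega> p unfolding two_zero_form_def by blast
  then have "\<omega> p u v + \<i> * \<omega> p (cplx_structure u) v = 0"
    using zero uv(1) J[OF uv(1)] by (simp add: cext2_def)
  then show ?thesis
    by (simp add: complex_eq_iff)
qed

lemma two_zero_form_cplx_scale:
  assumes X: "complex_manifold X" and \<omega>: "two_zero_form X \<omega>" and p: "p \<in> points X"
    and uv: "u \<in> tangent_space X p" "v \<in> tangent_space X p"
  shows "\<omega> p (cplx_scale a u) v = a * \<omega> p u v" and "\<omega> p u (cplx_scale a v) = a * \<omega> p u v"
proof -
  note T = subspace_tangent_space[OF X, of p]
  note J = cplx_structure_in_tangent_space[OF X]
  have alt: "alternating_wrt (*\<^sub>R) (*\<^sub>R) (tangent_space X p) (\<omega> p)"
    using \<omega> p unfolding two_zero_form_def two_form_def by blast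
  have *: "\<omega> p (cplx_scale a u) v = a * \<omega> p u v"
    if "u \<in> tangent_space X p" "v \<in> tangent_space X p" for u v
  proof -
    have "\<omega> p (cplx_scale a u) v = Re a *\<^sub>R \<omega> p u v + Im a *\<^sub>R \<omega> p (cplx_structure u) v"
      using alt that J[OF that(1)] subspace_scale[OF T]
      unfolding alternating_wrt_def linear_wrt_def cplx_scale_conv_cplx_structure by metis
    also have "\<dots> = a * \<omega> p u v"
      unfolding two_zero_form_cplx_structure[OF X \<omega> p that] by (simp add: complex_eq_iff)
    finally show ?thesis .
  qed
  show "\<omega> p (cplx_scale a u) v = a * \<omega> p u v"
    by (rule *[OF uv])
  have "\<omega> p u (cplx_scale a v) = - \<omega> p (cplx_scale a v) u"
    by (rule alternating_wrt_skew[OF alt subspace_add[OF T]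
          cplx_scale_in_tangent_space[OF X uv(2)] uv(1)])
  also have "\<dots> = a * (- \<omega> p v u)"
    using *[OF uv(2,1)] by simp
  also have "- \<omega> p v u = \<omega> p u v"
    by (rule alternating_wrt_skew[OF alt subspace_add[OF T] uv(2,1), symmetric])
  finally show "\<omega> p u (cplx_scale a v) = a * \<omega> p u v" .
qed

text \<open>
  Expanding \<open>\<omega>(u - \<i> J u, v - \<i> J v)\<close> and moving each \<open>J\<close> out as a factor \<open>\<i>\<close> gives four
  equal terms.
\<close>

lemma cext2_type10:
  assumes X: "complex_manifold X" and \<omega>: "two_zero_form X \<omega>" and p: "p \<in> points X"
    and uv: "u \<in> tangent_space X p" "v \<in> tangent_space X p"
  shows "cext2 (\<omega> p) (type10 u) (type10 v) = 4 * \<omega> p u v"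
proof -
  have t: "type10 w = (w, cplx_scale (- \<i>) w)" for w :: "('a, 'b) tvec"
    by (simp add: type10_def cplx_structure_def cplx_scale_def fun_eq_iff vec_eq_iff)
  have arith: "z - - \<i> * (- \<i> * z) + \<i> * (- \<i> * z + - \<i> * z) = 4 * z" for z :: complex
    by simp
  note S = cplx_scale_in_tangent_space[OF X]
  show ?thesis
    unfolding t cext2_def fst_conv snd_conv
      two_zero_form_cplx_scale(2)[OF X \<omega> p uv] two_zero_form_cplx_scale(1)[OF X \<omega> p uv]
      two_zero_form_cplx_scale(1)[OF X \<omega> p uv(1) S[OF uv(2)]]
    by (rule arith)
qed

lemma alternating_wrt_cext2:
  assumes X: "complex_manifold X" and \<omega>: "two_zero_form X \<omega>" and p: "p \<in> points X"
  shows "alternating_wrt cscale (*) (T10 X p) (cext2 (\<omega> p))"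
proof -
  note T = subspace_tangent_space[OF X, of p]
  have alt: "alternating_wrt (*\<^sub>R) (*\<^sub>R) (tangent_space X p) (\<omega> p)"
    using \<omega> p unfolding two_zero_form_def two_form_def by blast
  have add: "\<omega> p (u + v) z = \<omega> p u z + \<omega> p v z" "\<omega> p z (u + v) = \<omega> p z u + \<omega> p z v"
    if "u \<in> tangent_space X p" "v \<in> tangent_space X p" "z \<in> tangent_space X p" for u v z
    using alt that unfolding alternating_wrt_def linear_wrt_def by auto
  have null: "\<omega> p u u = 0" if "u \<in> tangent_space X p" for u
    using alt that unfolding alternating_wrt_def by blast
  show ?thesis
    unfolding alternating_wrt_def linear_wrt_def T10_eq_type10_image[OF X] ball_simps(9)
      type10_add[symmetric] type10_cplx_scale[symmetric]
    by (intro conjI ballI allI)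
      (simp_all add: cext2_type10[OF X \<omega> p] two_zero_form_cplx_scale[OF X \<omega> p] add null
        subspace_add[OF T] cplx_scale_in_tangent_space[OF X] distrib_left)
qed


section \<open>Covectors of type (1,0)\<close>

lemma dual_on_sum:
  fixes f :: "'i \<Rightarrow> 'v::plus \<Rightarrow> 'k::comm_ring_1"
  assumes "\<And>i. i \<in> I \<Longrightarrow> f i \<in> dual_on s V"
  shows "(\<lambda>w. \<Sum>i\<in>I. a i * f i w) \<in> dual_on s V"
  using assms
  by (auto simp: dual_on_def linear_wrt_def sum.distrib[symmetric] sum_distrib_left algebra_simps
      intro!: sum.cong sum.neutral)

text \<open>
  Additivity is available only for covectors of \<open>V\<close>, so the partial sums are kept in the dual space
  during the induction.
\<close>

lemma linear_wrt_dual_on_sum: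
  fixes f :: "'i \<Rightarrow> 'v::plus \<Rightarrow> 'k::comm_ring_1"
  assumes F: "linear_wrt (\<lambda>a \<alpha> w. a * \<alpha> w) (*) (dual_on s V) F"
    and "finite I" and f: "\<And>i. i \<in> I \<Longrightarrow> f i \<in> dual_on s V"
  shows "F (\<lambda>w. \<Sum>i\<in>I. a i * f i w) = (\<Sum>i\<in>I. a i * F (f i))"
  using assms(2,3)
proof (induction I rule: finite_induct)
  case empty
  have zero: "(\<lambda>w. 0) \<in> dual_on s V"
    by (simp add: dual_on_def linear_wrt_def)
  have "\<forall>a. \<forall>\<alpha>\<in>dual_on s V. F (\<lambda>w. a * \<alpha> w) = a * F \<alpha>"
    using F unfolding linear_wrt_def by blast
  from this[rule_format, OF zero, of 0] show ?case
    by simp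
next
  case (insert i I)
  let ?r = "\<lambda>w. \<Sum>i\<in>I. a i * f i w"
  have fi: "f i \<in> dual_on s V" and r: "?r \<in> dual_on s V"
    using insert.prems dual_on_sum[of I f s V a] by auto
  have afi: "(\<lambda>w. a i * f i w) \<in> dual_on s V"
    using dual_on_sum[of "{i}" f s V a] fi by simp
  have split: "(\<lambda>w. \<Sum>i\<in>insert i I. a i * f i w) = (\<lambda>w. a i * f i w) + ?r"
    using insert.hyps by (simp add: fun_eq_iff)
  have "\<forall>u\<in>dual_on s V. \<forall>v\<in>dual_on s V. F (u + v) = F u + F v"
    using F unfolding linear_wrt_def by blast
  from this[rule_format, OF afi r]
  have "F (\<lambda>w. \<Sum>i\<in>insert i I. a i * f i w) = F (\<lambda>w. a i * f i w) + F ?r"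
    unfolding split .
  also have "\<dots> = a i * F (f i) + (\<Sum>i\<in>I. a i * F (f i))"
    using F fi insert unfolding linear_wrt_def by simp
  finally show ?case
    using insert.hyps by simp
qed

lemma type10_in_T10:
  assumes "complex_manifold X" "u \<in> tangent_space X p"
  shows "type10 u \<in> T10 X p"
  using assms unfolding T10_eq_type10_image[OF assms(1)] by blast

text \<open>
  The real part of this value is \<open>\<alpha> u\<close>, so the pullback to (1,0)-vectors loses no information
  about a real covector.
\<close>

lemma covector10_type10:
  assumes "complex_manifold X" "\<alpha> \<in> cotangent_space X p" "u \<in> tangent_space X p"
  shows "covector10 X p \<alpha> (type10 u) = \<alpha> u - \<i> * \<alpha> (cplx_structure u)"
proof -
  have "\<forall>r. \<forall>u\<in>tangent_space X p. \<alpha> (r *\<^sub>R u) = r * \<alpha> u"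
    using assms(2) unfolding dual_on_def linear_wrt_def by blast
  from this[rule_format, OF cplx_structure_in_tangent_space[OF assms(1,3)], of "- 1"]
  have "\<alpha> (- cplx_structure u) = - \<alpha> (cplx_structure u)"
    by simp
  then show ?thesis
    using type10_in_T10[OF assms(1,3)]
    by (simp add: covector10_def restrict0_def cext_def type10_def)
qed

lemma covector10_in_T10_dual:
  assumes X: "complex_manifold X" and \<alpha>: "\<alpha> \<in> cotangent_space X p"
  shows "covector10 X p \<alpha> \<in> T10_dual X p"
proof -
  note T = subspace_tangent_space[OF X, of p]
  note J = cplx_structure_in_tangent_space[OF X]
  have add: "\<alpha> (u + v) = \<alpha> u + \<alpha> v" and scl: "\<alpha> (r *\<^sub>R u) = r * \<alpha> u"
    if "u \<in> tangent_space X p" "v \<in> tangent_space X p" for u v r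
    using \<alpha> that unfolding dual_on_def linear_wrt_def by auto
  have diff: "\<alpha> (u - v) = \<alpha> u - \<alpha> v" if "u \<in> tangent_space X p" "v \<in> tangent_space X p" for u v
    using add[OF subspace_diff[OF T that] that(2)] by simp
  have Jadd: "cplx_structure (u + v) = cplx_structure u + cplx_structure v" for u v :: "('a, 'b) tvec"
    by (simp add: cplx_structure_def fun_eq_iff vec_eq_iff algebra_simps)
  have "covector10 X p \<alpha> (type10 u + type10 v)
      = covector10 X p \<alpha> (type10 u) + covector10 X p \<alpha> (type10 v)"
    if uv: "u \<in> tangent_space X p" "v \<in> tangent_space X p" for u v
    unfolding type10_add[symmetric]
    using uv J[OF uv(1)] J[OF uv(2)] subspace_add[OF T uv]
    by (simp add: covector10_type10[OF X \<alpha>] Jadd add algebra_simps)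
  moreover have "covector10 X p \<alpha> (cscale a (type10 u)) = a * covector10 X p \<alpha> (type10 u)"
    if u: "u \<in> tangent_space X p" for u a
  proof -
    note Ju = J[OF u]
    have "\<alpha> (cplx_scale a u) = Re a * \<alpha> u + Im a * \<alpha> (cplx_structure u)"
      "\<alpha> (cplx_structure (cplx_scale a u)) = Re a * \<alpha> (cplx_structure u) - Im a * \<alpha> u"
      unfolding cplx_structure_cplx_scale unfolding cplx_scale_conv_cplx_structure
      using u Ju subspace_scale[OF T] by (simp_all add: add diff scl)
    then show ?thesis
      unfolding type10_cplx_scale[symmetric]
        covector10_type10[OF X \<alpha> cplx_scale_in_tangent_space[OF X u]] covector10_type10[OF X \<alpha> u]
      by (simp add: complex_eq_iff algebra_simps)
  qed
  moreover have "covector10 X p \<alpha> w = 0" if "w \<notin> T10 X p" for w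
    using that by (simp add: covector10_def restrict0_def)
  ultimately show ?thesis
    unfolding dual_on_def linear_wrt_def using T10_eq_type10_image[OF X] by auto
qed

lemma covector10_add: "covector10 X p (\<alpha> + \<beta>) = covector10 X p \<alpha> + covector10 X p \<beta>"
  by (auto simp: covector10_def restrict0_def cext_def fun_eq_iff algebra_simps)

lemma covector10_scaleR:
  "covector10 X p (r *\<^sub>R \<alpha>) = (\<lambda>w. complex_of_real r * covector10 X p \<alpha> w)"
  by (auto simp: covector10_def restrict0_def cext_def fun_eq_iff algebra_simps scaleR_fun_def)


section \<open>Coordinate expressions\<close>

text \<open>
  The left-hand side is complex linear in \<open>z\<close>, and the factors on the right are its values on
  the standard basis.
\<close>

lemma complex_linear_part_expansion:
  fixes l :: "complex ^ 'n \<Rightarrow> real"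
  assumes "linear l"
  shows "complex_of_real (l z) - \<i> * complex_of_real (l (\<i> *s z))
    = (\<Sum>k\<in>UNIV. z $ k * (complex_of_real (l (axis k 1)) - \<i> * complex_of_real (l (axis k \<i>))))"
proof -
  have l: "l z = (\<Sum>k\<in>UNIV. Re (z $ k) * l (axis k 1) + Im (z $ k) * l (axis k \<i>))" for z
  proof -
    have "(z $ k) *s axis k 1 = Re (z $ k) *\<^sub>R axis k 1 + Im (z $ k) *\<^sub>R axis k \<i>" for k
      by (auto simp: vec_eq_iff axis_def complex_eq_iff)
    then have "z = (\<Sum>k\<in>UNIV. Re (z $ k) *\<^sub>R axis k 1 + Im (z $ k) *\<^sub>R axis k \<i>)"
      using basis_expansion[of z] by simp
    then have "l z = l (\<Sum>k\<in>UNIV. Re (z $ k) *\<^sub>R axis k 1 + Im (z $ k) *\<^sub>R axis k \<i>)"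
      by (rule arg_cong)
    then show ?thesis
      by (simp add: linear_sum[OF assms] linear_add[OF assms] linear_scale[OF assms])
  qed
  show ?thesis
    unfolding l[of z] l[of "\<i> *s z"] of_real_sum sum_distrib_left sum_subtractf[symmetric]
    by (rule sum.cong[OF refl]) (simp add: complex_eq_iff algebra_simps)
qed

lemma coord_covector_in_cotangent_space:
  assumes "complex_manifold X" "linear l"
  shows "coord_covector X c p l \<in> cotangent_space X p"
proof -
  note T = subspace_tangent_space[OF assms(1), of p]
  have "(r *\<^sub>R v) c = r *\<^sub>R v c" for r and v :: "('a, 'b) tvec"
    by (simp add: scaleR_fun_def)
  then show ?thesis
    unfolding dual_on_def linear_wrt_def coord_covector_def restrict0_def
    by (simp add: subspace_add[OF T] subspace_scale[OF T] linear_add[OF assms(2)]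
        linear_scale[OF assms(2)])
qed

text \<open>
  The factor 2 reflects that \<open>u - \<i> J u\<close> is twice the (1,0)-part of \<open>u\<close>; it accounts for
  the division by 2 in the expansion of real covectors below.
\<close>

lemma coord_dz_type10:
  assumes "complex_manifold X" "u \<in> tangent_space X p"
  shows "coord_dz X c p k (type10 u) = 2 * u c $ k"
proof -
  have "cext (\<lambda>v. v c $ k) (type10 u) = 2 * u c $ k"
    by (simp add: cext_def type10_def cplx_structure_def complex_eq_iff)
  then show ?thesis
    using type10_in_T10[OF assms] by (simp add: coord_dz_def restrict0_def)
qed

lemma coord_dz_in_T10_dual:
  assumes "complex_manifold X"
  shows "coord_dz X c p k \<in> T10_dual X p"
proof -
  note T = subspace_tangent_space[OF assms, of p]
  have add: "coord_dz X c p k (type10 (u + v))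
      = coord_dz X c p k (type10 u) + coord_dz X c p k (type10 v)"
    if uv: "u \<in> tangent_space X p" "v \<in> tangent_space X p" for u v
    unfolding coord_dz_type10[OF assms uv(1)] coord_dz_type10[OF assms uv(2)]
      coord_dz_type10[OF assms subspace_add[OF T uv]]
    by simp
  have scale: "coord_dz X c p k (type10 (cplx_scale a u)) = a * coord_dz X c p k (type10 u)"
    if u: "u \<in> tangent_space X p" for a u
    unfolding coord_dz_type10[OF assms u]
      coord_dz_type10[OF assms cplx_scale_in_tangent_space[OF assms u]]
    by (simp add: cplx_scale_def)
  have "linear_wrt cscale (*) (T10 X p) (coord_dz X c p k)"
    unfolding linear_wrt_def T10_eq_type10_image[OF assms] ball_simps(9)
      type10_add[symmetric] type10_cplx_scale[symmetric]
    using add scale by blast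
  moreover have "coord_dz X c p k w = 0" if "w \<notin> T10 X p" for w
    using that by (simp add: coord_dz_def restrict0_def)
  ultimately show ?thesis
    unfolding dual_on_def by blast
qed

text \<open>
  The coefficients do not depend on the point. This reduces the smoothness of a bivector field on
  constant real covectors to the holomorphy of its coefficients on the forms \<open>dz\<^sub>k\<close>.
\<close>

lemma covector10_coord_covector:
  fixes l :: "complex ^ 'n::finite \<Rightarrow> real"
  assumes X: "complex_manifold X" and l: "linear l"
  shows "covector10 X p (coord_covector X c p l) = (\<lambda>w. \<Sum>k\<in>UNIV.
    (complex_of_real (l (axis k 1)) - \<i> * complex_of_real (l (axis k \<i>))) / 2 * coord_dz X c p k w)"
proof
  fix w
  let ?a = "\<lambda>k. complex_of_real (l (axis k 1)) - \<i> * complex_of_real (l (axis k \<i>))"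
  show "covector10 X p (coord_covector X c p l) w = (\<Sum>k\<in>UNIV. ?a k / 2 * coord_dz X c p k w)"
  proof (cases "w \<in> T10 X p")
    case True
    then obtain u where u: "u \<in> tangent_space X p" and w: "w = type10 u"
      using T10_eq_type10_image[OF X] by blast
    have "covector10 X p (coord_covector X c p l) w
        = complex_of_real (l (u c)) - \<i> * complex_of_real (l (\<i> *s u c))"
      unfolding w covector10_type10[OF X coord_covector_in_cotangent_space[OF X l] u]
      using u cplx_structure_in_tangent_space[OF X u]
      by (simp add: coord_covector_def restrict0_def cplx_structure_def)
    also have "\<dots> = (\<Sum>k\<in>UNIV. u c $ k * ?a k)"
      by (rule complex_linear_part_expansion[OF l])
    also have "\<dots> = (\<Sum>k\<in>UNIV. ?a k / 2 * coord_dz X c p k w)"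
      unfolding w coord_dz_type10[OF X u] by (rule sum.cong[OF refl]) simp
    finally show ?thesis .
  next
    case False
    then show ?thesis
      by (simp add: covector10_def coord_dz_def restrict0_def)
  qed
qed


section \<open>The Poisson bivector field of a real part\<close>

text \<open>
  Smoothness and closedness pass through the bounded linear map \<open>z \<mapsto> Re (a z)\<close>. For
  nondegeneracy, a vector \<open>v\<close> may be multiplied by any complex number, so \<open>Re (a \<omega>(u, v)) = 0\<close>
  for all \<open>v\<close> forces \<open>\<omega>(u, v) = 0\<close> for all \<open>v\<close>.
\<close>

lemma real_symplectic_form_Re_mult:
  fixes X :: "('a, 'n::finite) charted_space"
  assumes X: "complex_manifold X" and \<omega>: "holomorphic_symplectic_form X \<omega>" and a: "a \<noteq> 0"
  shows "real_symplectic_form X (\<lambda>p u v. Re (a * \<omega> p u v))"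
proof -
  let ?h = "\<lambda>z. Re (a * z)"
  let ?\<sigma> = "\<lambda>p u v. Re (a * \<omega> p u v)"
  have h: "bounded_linear ?h"
    by (rule bounded_linear_compose[OF bounded_linear_Re bounded_linear_mult_right])
  have \<omega>20: "two_zero_form X \<omega>" and closed: "closed_form X \<omega>"
    using \<omega> unfolding holomorphic_symplectic_form_def holomorphic_two_form_def by auto
  have nondeg: "nondegenerate_on (T10 X p) (cext2 (\<omega> p))" if "p \<in> points X" for p
    using \<omega> that unfolding holomorphic_symplectic_form_def by blast
  have form: "two_form X \<omega>"
    using \<omega>20 unfolding two_zero_form_def by blast
  have coeff: "form_coeff X c ?\<sigma> e f = (\<lambda>x. ?h (form_coeff X c \<omega> e f x))" for c e f
    by (simp add: fun_eq_iff form_coeff_def Let_def)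
  have op: "open (chart_image c)" if "c \<in> charts X" for c
    using X that unfolding complex_manifold_def by blast
  have smooth: "smooth_on (form_coeff X c \<omega> e f) (chart_image c)" if "c \<in> charts X" for c e f
    using form that unfolding two_form_def by blast
  have "alternating_wrt (*\<^sub>R) (*\<^sub>R) (tangent_space X p) (?\<sigma> p)" if "p \<in> points X" for p
  proof -
    have alt: "alternating_wrt (*\<^sub>R) (*\<^sub>R) (tangent_space X p) (\<omega> p)"
      using form that unfolding two_form_def by blast
    then show ?thesis
      unfolding alternating_wrt_def linear_wrt_def by (simp add: distrib_left)
  qed
  moreover have "smooth_on (form_coeff X c ?\<sigma> e f) (chart_image c)" if "c \<in> charts X" for c e f
    unfolding coeff by (rule smooth_on_bounded_linear[OF op[OF that] h smooth[OF that]])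
  ultimately have "two_form X ?\<sigma>"
    unfolding two_form_def by blast
  moreover have "closed_form X ?\<sigma>"
    unfolding closed_form_def
  proof (intro ballI allI)
    fix c x e f g
    assume c: "c \<in> charts X" and x: "x \<in> chart_image c"
    have d: "form_coeff X c \<omega> e f differentiable at x" for e f
    proof -
      have "Ck_on (Suc 0) (form_coeff X c \<omega> e f) (chart_image c)"
        using smooth[OF c] unfolding smooth_on_def by blast
      then show ?thesis
        using x unfolding Ck_on.simps by blast
    qed
    have "frechet_derivative (form_coeff X c \<omega> f g) (at x) e
        + frechet_derivative (form_coeff X c \<omega> g e) (at x) f
        + frechet_derivative (form_coeff X c \<omega> e f) (at x) g = 0"
      using closed c x unfolding closed_form_def by blast
    then have "?h (frechet_derivative (form_coeff X c \<omega> f g) (at x) e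
        + frechet_derivative (form_coeff X c \<omega> g e) (at x) f
        + frechet_derivative (form_coeff X c \<omega> e f) (at x) g) = ?h 0"
      by (rule arg_cong)
    then show "frechet_derivative (form_coeff X c ?\<sigma> f g) (at x) e
        + frechet_derivative (form_coeff X c ?\<sigma> g e) (at x) f
        + frechet_derivative (form_coeff X c ?\<sigma> e f) (at x) g = 0"
      unfolding coeff frechet_derivative_bounded_linear[OF h d]
      by (simp only: distrib_left plus_complex.sel mult_zero_right zero_complex.sel)
  qed
  moreover have "nondegenerate_on (tangent_space X p) (?\<sigma> p)" if p: "p \<in> points X" for p
    unfolding nondegenerate_on_def
  proof (intro ballI impI)
    fix u
    assume u: "u \<in> tangent_space X p" and zero: "\<forall>v\<in>tangent_space X p. Re (a * \<omega> p u v) = 0"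
    have "\<omega> p u v = 0" if v: "v \<in> tangent_space X p" for v
    proof -
      \<comment> \<open>Multiplying \<open>v\<close> by the conjugate of \<open>a \<omega>(u, v)\<close> turns the hypothesis into a statement
        about the modulus of \<open>a \<omega>(u, v)\<close>.\<close>
      have "Re (a * (cnj (a * \<omega> p u v) * \<omega> p u v)) = 0"
        using zero cplx_scale_in_tangent_space[OF X v]
        unfolding two_zero_form_cplx_scale(2)[OF X \<omega>20 p u v, symmetric] by blast
      then have "Re ((a * \<omega> p u v) * cnj (a * \<omega> p u v)) = 0"
        by (simp only: ac_simps)
      then have "a * \<omega> p u v = 0"
        unfolding complex_norm_square[symmetric] Re_complex_of_real
        by (simp only: power_eq_0_iff norm_eq_zero)
      with a show ?thesis
        by (simp only: mult_eq_0_iff) blast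
    qed
    then have "\<forall>w\<in>T10 X p. cext2 (\<omega> p) (type10 u) w = 0"
      using cext2_type10[OF X \<omega>20 p u] unfolding T10_eq_type10_image[OF X] by simp
    then have "type10 u = 0"
      using nondeg[OF p] type10_in_T10[OF X u] unfolding nondegenerate_on_def by blast
    then show "u = 0"
      by (simp add: type10_def zero_prod_def)
  qed
  ultimately show ?thesis
    unfolding real_symplectic_form_def by blast
qed

text \<open>
  In a chart, the coefficients on constant real covectors are sums of fixed real-linear functions
  of the holomorphic coefficients \<open>\<pi>(dz\<^sub>i, dz\<^sub>j)\<close>.
\<close>

lemma bivector_field_Re_divide:
  fixes X :: "('a, 'n::finite) charted_space"
  assumes X: "complex_manifold X" and \<pi>: "holomorphic_bivector_field X \<pi>"
  shows "bivector_field X (\<lambda>p \<alpha> \<beta>. 4 * Re (\<pi> p (covector10 X p \<alpha>) (covector10 X p \<beta>) / a))"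
  unfolding bivector_field_def
proof (intro conjI ballI allI impI)
  fix p
  assume "p \<in> points X"
  then have "alternating_wrt (\<lambda>a \<alpha> w. a * \<alpha> w) (*) (T10_dual X p) (\<pi> p)"
    using \<pi> unfolding holomorphic_bivector_field_def by blast
  then show "alternating_wrt (*\<^sub>R) (*\<^sub>R) (cotangent_space X p)
      (\<lambda>\<alpha> \<beta>. 4 * Re (\<pi> p (covector10 X p \<alpha>) (covector10 X p \<beta>) / a))"
    unfolding alternating_wrt_def linear_wrt_def
    by (simp add: covector10_add covector10_scaleR covector10_in_T10_dual[OF X] add_divide_distrib
        times_divide_eq_right[symmetric] del: times_divide_eq_right)
next
  fix c and l m :: "complex ^ 'n \<Rightarrow> real"
  assume c: "c \<in> charts X" and l: "linear l" and m: "linear m"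
  let ?g = "\<lambda>i j x. let p = chart_point c x in \<pi> p (coord_dz X c p i) (coord_dz X c p j)"
  let ?A = "\<lambda>k. (complex_of_real (l (axis k 1)) - \<i> * complex_of_real (l (axis k \<i>))) / 2"
  let ?B = "\<lambda>k. (complex_of_real (m (axis k 1)) - \<i> * complex_of_real (m (axis k \<i>))) / 2"
  let ?h = "\<lambda>i j z. 4 * Re (?A i * ?B j / a * z)"
  have op: "open (chart_image c)"
    using X c unfolding complex_manifold_def by blast
  have g: "smooth_on (?g i j) (chart_image c)" for i j
    using \<pi> c unfolding holomorphic_bivector_field_def holomorphic_fun_on_def by blast
  have h: "bounded_linear (?h i j)" for i j
    by (intro bounded_linear_compose[OF bounded_linear_mult_right]
        bounded_linear_compose[OF bounded_linear_Re] bounded_linear_mult_right)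
  have "smooth_on (\<lambda>x. \<Sum>i\<in>UNIV. \<Sum>j\<in>UNIV. ?h i j (?g i j x)) (chart_image c)"
    by (rule smooth_on_sum[OF op finite] smooth_on_bounded_linear[OF op h g])+
  moreover have "(\<Sum>i\<in>UNIV. \<Sum>j\<in>UNIV. ?h i j (?g i j x))
      = (let p = chart_point c x in
          4 * Re (\<pi> p (covector10 X p (coord_covector X c p l))
            (covector10 X p (coord_covector X c p m)) / a))"
    if x: "x \<in> chart_image c" for x
  proof -
    define p where "p = chart_point c x"
    have p: "p \<in> points X"
      unfolding p_def by (rule chart_point_in_points[OF X c x])
    have alt: "alternating_wrt (\<lambda>a \<alpha> w. a * \<alpha> w) (*) (T10_dual X p) (\<pi> p)"
      using \<pi> p unfolding holomorphic_bivector_field_def by blast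
    have lin1: "linear_wrt (\<lambda>a \<alpha> w. a * \<alpha> w) (*) (T10_dual X p) (\<lambda>\<alpha>. \<pi> p \<alpha> \<beta>)"
      and lin2: "linear_wrt (\<lambda>a \<alpha> w. a * \<alpha> w) (*) (T10_dual X p) (\<pi> p \<beta>)"
      if "\<beta> \<in> T10_dual X p" for \<beta>
      using alt that unfolding alternating_wrt_def by blast+
    note dz = coord_dz_in_T10_dual[OF X]
    have "\<pi> p (covector10 X p (coord_covector X c p l)) (covector10 X p (coord_covector X c p m))
        = (\<Sum>i\<in>UNIV. ?A i * \<pi> p (coord_dz X c p i) (covector10 X p (coord_covector X c p m)))"
      unfolding covector10_coord_covector[OF X l]
      by (rule linear_wrt_dual_on_sum[OF lin1[OF covector10_in_T10_dual[OF X
              coord_covector_in_cotangent_space[OF X m]]] finite dz])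
    also have "\<dots> = (\<Sum>i\<in>UNIV. ?A i * (\<Sum>j\<in>UNIV. ?B j * \<pi> p (coord_dz X c p i) (coord_dz X c p j)))"
      unfolding covector10_coord_covector[OF X m]
      by (subst linear_wrt_dual_on_sum[OF lin2[OF dz] finite dz]) (rule refl)
    finally have expand: "\<pi> p (covector10 X p (coord_covector X c p l))
        (covector10 X p (coord_covector X c p m))
      = (\<Sum>i\<in>UNIV. ?A i * (\<Sum>j\<in>UNIV. ?B j * \<pi> p (coord_dz X c p i) (coord_dz X c p j)))" .
    have arith: "4 * Re ((\<Sum>i\<in>UNIV. A i * (\<Sum>j\<in>UNIV. B j * G i j)) / a)
        = (\<Sum>i\<in>UNIV. \<Sum>j\<in>UNIV. 4 * Re (A i * B j / a * G i j))"
      for A B :: "'n \<Rightarrow> complex" and G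
      by (simp add: sum_distrib_left sum_divide_distrib Re_sum mult.assoc)
    show ?thesis
      unfolding Let_def p_def[symmetric] expand arith by (rule refl)
  qed
  ultimately show "smooth_on (\<lambda>x. let p = chart_point c x in
      4 * Re (\<pi> p (covector10 X p (coord_covector X c p l))
        (covector10 X p (coord_covector X c p m)) / a)) (chart_image c)"
    by (rule smooth_on_cong[OF op])
qed

text \<open>
  Let \<open>u - \<i> J u\<close> be the vector with \<open>4 \<omega>(u, x) = \<alpha>(x) - \<i> \<alpha>(J x)\<close>. Since \<open>\<omega>\<close> is complex
  linear, \<open>v = (4 / a) u\<close> satisfies \<open>Re (a \<omega>(v, x)) = \<alpha>(x)\<close>. On the other hand,
  \<open>\<beta>(v) = Re ((4 / a) (\<beta>(u) - \<i> \<beta>(J u)))\<close>, which is \<open>4 Re (\<pi>(\<alpha>, \<beta>) / a)\<close>.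
\<close>

lemma poisson_bivector_of_Re_mult:
  fixes X :: "('a, 'n::finite) charted_space"
  assumes X: "complex_manifold X" and hp: "holomorphic_poisson_bivector_of X \<omega> \<pi>" and a: "a \<noteq> 0"
  shows "poisson_bivector_of X (\<lambda>p u v. Re (a * \<omega> p u v))
    (\<lambda>p \<alpha> \<beta>. 4 * Re (\<pi> p (covector10 X p \<alpha>) (covector10 X p \<beta>) / a))"
proof -
  let ?\<sigma> = "\<lambda>p u v. Re (a * \<omega> p u v)"
  let ?P = "\<lambda>p \<alpha> \<beta>. 4 * Re (\<pi> p (covector10 X p \<alpha>) (covector10 X p \<beta>) / a)"
  have \<omega>: "holomorphic_symplectic_form X \<omega>" and \<pi>: "holomorphic_bivector_field X \<pi>"
    using hp unfolding holomorphic_poisson_bivector_of_def by auto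
  have \<omega>20: "two_zero_form X \<omega>"
    using \<omega> unfolding holomorphic_symplectic_form_def holomorphic_two_form_def by auto
  note \<sigma> = real_symplectic_form_Re_mult[OF X \<omega> a]
  have "sharp_inverse_flat (tangent_space X p) (cotangent_space X p) (?\<sigma> p) (?P p)"
    if p: "p \<in> points X" for p
  proof (rule sharp_inverse_flatI[OF vector_space_scaleR
        subspace_tangent_space[OF X, unfolded subspace_raw_def]])
    \<comment> \<open>Scaling and multiplication of reals are distinct constants.\<close>
    have "((*\<^sub>R) :: real \<Rightarrow> real \<Rightarrow> real) = (*)"
      by (simp add: fun_eq_iff)
    then show "alternating_wrt (*\<^sub>R) (*) (tangent_space X p) (?\<sigma> p)"
      using \<sigma> p unfolding real_symplectic_form_def two_form_def by metis
    show "nondegenerate_on (tangent_space X p) (?\<sigma> p)"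
      using \<sigma> p unfolding real_symplectic_form_def by blast
    fix \<alpha>
    assume \<alpha>: "\<alpha> \<in> cotangent_space X p"
    let ?\<alpha> = "covector10 X p \<alpha>"
    have nondeg: "nondegenerate_on (T10 X p) (cext2 (\<omega> p))"
      using \<omega> p unfolding holomorphic_symplectic_form_def by blast
    have inv: "sharp_inverse_flat (T10 X p) (T10_dual X p) (cext2 (\<omega> p)) (\<pi> p)"
      using hp p unfolding holomorphic_poisson_bivector_of_def by blast
    have lin: "linear_wrt (\<lambda>a \<alpha> w. a * \<alpha> w) (*) (T10_dual X p) (\<pi> p ?\<alpha>)"
      using \<pi> p covector10_in_T10_dual[OF X \<alpha>]
      unfolding holomorphic_bivector_field_def alternating_wrt_def by blast
    obtain w where w: "w \<in> T10 X p" "flat (T10 X p) (cext2 (\<omega> p)) w = ?\<alpha>"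
      "\<And>\<beta>. \<beta> \<in> T10_dual X p \<Longrightarrow> \<beta> w = \<pi> p ?\<alpha> \<beta>"
      by (rule sharp_inverse_flatD[OF vector_space_cscale subspace_T10[OF X]
            alternating_wrt_cext2[OF X \<omega>20 p] nondeg inv lin covector10_in_T10_dual[OF X \<alpha>]]) blast
    obtain u where u: "u \<in> tangent_space X p" and wu: "w = type10 u"
      using w(1) unfolding T10_eq_type10_image[OF X] by blast
    note Ju = cplx_structure_in_tangent_space[OF X u]
    let ?v = "cplx_scale (4 / a) u"
    have "flat (tangent_space X p) (?\<sigma> p) ?v = \<alpha>"
    proof
      fix x
      show "flat (tangent_space X p) (?\<sigma> p) ?v x = \<alpha> x"
      proof (cases "x \<in> tangent_space X p")
        case True
        have "4 * \<omega> p u x = ?\<alpha> (type10 x)"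
          unfolding w(2)[symmetric] flat_def restrict0_def wu cext2_type10[OF X \<omega>20 p u True]
          using type10_in_T10[OF X True] by (simp only: if_True)
        also have "\<dots> = \<alpha> x - \<i> * \<alpha> (cplx_structure x)"
          by (rule covector10_type10[OF X \<alpha> True])
        finally have eq: "4 * \<omega> p u x = \<alpha> x - \<i> * \<alpha> (cplx_structure x)" .
        have "a * \<omega> p ?v x = a * (4 / a * \<omega> p u x)"
          by (simp only: two_zero_form_cplx_scale(1)[OF X \<omega>20 p u True])
        also have "\<dots> = 4 * \<omega> p u x"
        proof -
          have "a * (4 / a * z) = 4 * z" for z
            using a by simp
          then show ?thesis .
        qed
        finally have "Re (a * \<omega> p ?v x) = \<alpha> x"
          unfolding eq by (simp only:) simp
        with True show ?thesis
          by (simp only: flat_def restrict0_def if_True)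
      next
        case False
        then show ?thesis
          using \<alpha> by (simp add: flat_def restrict0_def dual_on_def)
      qed
    qed
    moreover have "\<beta> ?v = ?P p \<alpha> \<beta>" if \<beta>: "\<beta> \<in> cotangent_space X p" for \<beta>
    proof -
      have "\<pi> p ?\<alpha> (covector10 X p \<beta>) = \<beta> u - \<i> * \<beta> (cplx_structure u)"
        unfolding w(3)[OF covector10_in_T10_dual[OF X \<beta>], symmetric] wu
        by (rule covector10_type10[OF X \<beta> u])
      then have "?P p \<alpha> \<beta> = 4 * Re ((\<beta> u - \<i> * \<beta> (cplx_structure u)) / a)"
        by (simp only:)
      also have "\<dots> = Re (4 / a * (\<beta> u - \<i> * \<beta> (cplx_structure u)))"
      proof -
        have "4 * Re (z / a) = Re (4 / a * z)" for z
        proof -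
          have "4 / a * z = complex_of_real 4 * (z / a)"
            by simp
          then show ?thesis
            by (simp only: Re_complex_of_real Im_complex_of_real times_complex.sel)
        qed
        then show ?thesis .
      qed
      also have "\<dots> = Re (4 / a) * \<beta> u + Im (4 / a) * \<beta> (cplx_structure u)"
      proof -
        have "Re (b * (complex_of_real s - \<i> * complex_of_real t)) = Re b * s + Im b * t" for b s t
          by simp
        then show ?thesis .
      qed
      also have "\<dots> = \<beta> (Re (4 / a) *\<^sub>R u) + \<beta> (Im (4 / a) *\<^sub>R cplx_structure u)"
        using \<beta> u Ju unfolding dual_on_def linear_wrt_def by simp
      also have "\<dots> = \<beta> ?v"
        using \<beta> subspace_scale[OF subspace_tangent_space[OF X] u]
          subspace_scale[OF subspace_tangent_space[OF X] Ju]
        unfolding cplx_scale_conv_cplx_structure dual_on_def linear_wrt_def by simp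
      finally show ?thesis
        by (rule sym)
    qed
    ultimately show "\<exists>v\<in>tangent_space X p. flat (tangent_space X p) (?\<sigma> p) v = \<alpha>
        \<and> (\<forall>\<beta>\<in>cotangent_space X p. \<beta> v = ?P p \<alpha> \<beta>)"
      using cplx_scale_in_tangent_space[OF X u] by blast
  qed
  then show ?thesis
    unfolding poisson_bivector_of_def using \<sigma> bivector_field_Re_divide[OF X \<pi>] by blast
qed

theorem proposition2p10:
  fixes X :: "('a, 'n::finite) charted_space"
    and \<omega> :: "('a, 'n, complex) form2"
    and \<pi> :: "('a, 'n) bivec10"
  assumes "complex_manifold X"
    and "holomorphic_symplectic_form X \<omega>"
    and "holomorphic_poisson_bivector_of X \<omega> \<pi>"
  shows "poisson_bivector_of X (Re_form \<omega>) (4 *\<^sub>R Re_bivector X \<pi>) \<and>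
    poisson_bivector_of X (Im_form \<omega>) ((- 4) *\<^sub>R Im_bivector X \<pi>)"
proof
  have "Re_form \<omega> = (\<lambda>p u v. Re (1 * \<omega> p u v))"
    by (simp add: Re_form_def)
  moreover have "4 *\<^sub>R Re_bivector X \<pi>
      = (\<lambda>p \<alpha> \<beta>. 4 * Re (\<pi> p (covector10 X p \<alpha>) (covector10 X p \<beta>) / 1))"
    by (simp add: Re_bivector_def scaleR_fun_def)
  ultimately show "poisson_bivector_of X (Re_form \<omega>) (4 *\<^sub>R Re_bivector X \<pi>)"
    using poisson_bivector_of_Re_mult[OF assms(1,3), of 1] by simp
  have "Im_form \<omega> = (\<lambda>p u v. Re (- \<i> * \<omega> p u v))"
    by (simp add: Im_form_def)
  moreover have "(- 4) *\<^sub>R Im_bivector X \<pi>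
      = (\<lambda>p \<alpha> \<beta>. 4 * Re (\<pi> p (covector10 X p \<alpha>) (covector10 X p \<beta>) / (- \<i>)))"
    by (simp add: Im_bivector_def scaleR_fun_def)
  ultimately show "poisson_bivector_of X (Im_form \<omega>) ((- 4) *\<^sub>R Im_bivector X \<pi>)"
    using poisson_bivector_of_Re_mult[OF assms(1,3), of "- \<i>"] by (simp only:) simp
qed

end
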